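(* Let $0<\alpha<2$. There are no nontrivial axisymmetric $C^2$-solutions with parameter $\alpha$ (with or without swirl); that is, every axisymmetric $C^2$-solution with parameter $\alpha\in(0,2)$ satisfies $V\equiv0$.
   Context: $\mathbb{S}^2$ is the unit sphere in $\mathbb{R}^3$ with outward unit normal $\vec n$. A $C^k$-solution with parameter $\alpha$ is a triple $(v,f,p)$, where $v$ is a tangent vector field and $f,p$ are functions on $\mathbb{S}^2$, all of class $C^k$ ($k\ge1$), such that $$V(x)=\frac{v+f\vec n}{|x|^{\alpha}},\qquad P(x)=\frac{p}{|x|^{2\alpha}}$$ ($v,f,p,\vec n$ evaluated at $x/|x|$) solve $V\cdot\nabla V+\nabla P=0$, $\operatorname{div}V=0$ in $\mathbb{R}^3\setminus\{0\}$. Equivalently, on $\mathbb{S}^2$, $$(2-\alpha)f+\operatorname{div}v=0,\quad v\nabla f=|v|^2+\alpha f^2+2\alpha p,\quad (1-\alpha)fv+v\nabla v=-\nabla p,$$ where $v\nabla f=\langle v,\nabla f\rangle$ and $v\nabla v$ is the covariant derivative. Spherical coordinates on $\mathbb{S}^2$ are $x=\sin\phi\cos\theta$, $y=\sin\phi\sin\theta$, $z=\cos\phi$, with orthonormal frame $\vec e_\phi,\vec e_\theta$, and $v=a\,\vec e_\phi+b\,\vec e_\theta$. The solution is axisymmetric if, in some such coordinate system, $a,b,f,p$ depend only on $\phi$; it is without swirl if $b=0$. *)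

theory Defs
  imports "HOL-Analysis.Analysis"
begin

fun Ck_on :: "nat \<Rightarrow> ('a::real_normed_vector \<Rightarrow> 'b::real_normed_vector) \<Rightarrow> 'a set \<Rightarrow> bool" where
  "Ck_on 0 g U \<longleftrightarrow> continuous_on U g"
| "Ck_on (Suc k) g U \<longleftrightarrow> (\<forall>x\<in>U. g differentiable at x) \<and>
     (\<forall>h. Ck_on k (\<lambda>x. frechet_derivative g (at x) h) U)"

abbreviation S2 :: "(real^3) set" where
  "S2 \<equiv> sphere 0 1"

(* Class C^k on the sphere as an embedded submanifold: near each point of the sphere the map
   is the restriction of a C^k map on an open subset of R^3.  Values off S2 are irrelevant. *)
definition Ck_on_sphere :: "nat \<Rightarrow> (real^3 \<Rightarrow> 'b::real_normed_vector) \<Rightarrow> bool" where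
  "Ck_on_sphere k g \<longleftrightarrow>
     (\<forall>u\<in>S2. \<exists>U G. open U \<and> u \<in> U \<and> Ck_on k G U \<and> (\<forall>x\<in>U \<inter> S2. G x = g x))"

definition tangent_field :: "(real^3 \<Rightarrow> real^3) \<Rightarrow> bool" where
  "tangent_field v \<longleftrightarrow> (\<forall>u\<in>S2. v u \<bullet> u = 0)"

(* The outward unit normal of S2 at u is u itself; sgn x = x / |x|. *)
definition velocity ::
    "real \<Rightarrow> (real^3 \<Rightarrow> real^3) \<Rightarrow> (real^3 \<Rightarrow> real) \<Rightarrow> real^3 \<Rightarrow> real^3" where
  "velocity \<alpha> v f x = (v (sgn x) + f (sgn x) *\<^sub>R sgn x) /\<^sub>R (norm x powr \<alpha>)"

definition pressure :: "real \<Rightarrow> (real^3 \<Rightarrow> real) \<Rightarrow> real^3 \<Rightarrow> real" where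
  "pressure \<alpha> p x = p (sgn x) / norm x powr (2 * \<alpha>)"

definition divergence :: "(real^3 \<Rightarrow> real^3) \<Rightarrow> real^3 \<Rightarrow> real" where
  "divergence V x = trace (jacobian V (at x))"

(* The i-th component of V . grad V is the sum over j of V_j times the j-th partial
   derivative of V_i. *)
definition advection :: "(real^3 \<Rightarrow> real^3) \<Rightarrow> real^3 \<Rightarrow> real^3" where
  "advection V x = jacobian V (at x) *v V x"

definition stationary_euler_at :: "(real^3 \<Rightarrow> real^3) \<Rightarrow> (real^3 \<Rightarrow> real) \<Rightarrow> real^3 \<Rightarrow> bool" where
  "stationary_euler_at V P x \<longleftrightarrow>
     V differentiable at x \<and>
     (\<exists>gradP. (GDERIV P x :> gradP) \<and> advection V x + gradP = 0) \<and>
     divergence V x = 0"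

definition Ck_solution ::
    "nat \<Rightarrow> real \<Rightarrow> (real^3 \<Rightarrow> real^3) \<Rightarrow> (real^3 \<Rightarrow> real) \<Rightarrow> (real^3 \<Rightarrow> real) \<Rightarrow> bool" where
  "Ck_solution k \<alpha> v f p \<longleftrightarrow>
     1 \<le> k \<and> tangent_field v \<and>
     Ck_on_sphere k v \<and> Ck_on_sphere k f \<and> Ck_on_sphere k p \<and>
     (\<forall>x. x \<noteq> 0 \<longrightarrow> stationary_euler_at (velocity \<alpha> v f) (pressure \<alpha> p) x)"

definition sph_point :: "real \<Rightarrow> real \<Rightarrow> real^3" where
  "sph_point \<phi> \<theta> = vector [sin \<phi> * cos \<theta>, sin \<phi> * sin \<theta>, cos \<phi>]"

definition e_phi :: "real \<Rightarrow> real \<Rightarrow> real^3" where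
  "e_phi \<phi> \<theta> = vector [cos \<phi> * cos \<theta>, cos \<phi> * sin \<theta>, - sin \<phi>]"

definition e_theta :: "real \<Rightarrow> real \<Rightarrow> real^3" where
  "e_theta \<phi> \<theta> = vector [- sin \<theta>, cos \<theta>, 0]"

(* The orthogonal map T carries the standard spherical coordinates to those of an arbitrary
   orthonormal coordinate system.  The poles (sin phi = 0), where the frame is undefined,
   are excluded. *)
definition axisymmetric ::
    "(real^3 \<Rightarrow> real^3) \<Rightarrow> (real^3 \<Rightarrow> real) \<Rightarrow> (real^3 \<Rightarrow> real) \<Rightarrow> bool" where
  "axisymmetric v f p \<longleftrightarrow>
     (\<exists>T a b F Q. orthogonal_transformation T \<and>
        (\<forall>\<phi> \<theta>. 0 < \<phi> \<and> \<phi> < pi \<longrightarrow>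
           v (T (sph_point \<phi> \<theta>)) = a \<phi> *\<^sub>R T (e_phi \<phi> \<theta>) + b \<phi> *\<^sub>R T (e_theta \<phi> \<theta>) \<and>
           f (T (sph_point \<phi> \<theta>)) = F \<phi> \<and>
           p (T (sph_point \<phi> \<theta>)) = Q \<phi>))"

end

theory Submission imports Defs
begin

text \<open>
In polar coordinates put \<open>A = a sin \<phi>\<close>, \<open>B = b sin \<phi>\<close> and \<open>H = |V|\<^sup>2 + 2P\<close> on the sphere.
On an interval with \<open>A > 0\<close> and \<open>A = 0\<close> at the ends, Bernoulli's law makes
\<open>H A\<^bsup>2\<alpha>/(2-\<alpha>)\<^esup>\<close> constant, and letting \<open>A\<close> tend to \<open>0\<close> gives \<open>H = 0\<close>, so that the radial momentum
equation becomes \<open>A f' sin \<phi> = (1 - \<alpha>) (A\<^sup>2 + B\<^sup>2)\<close>. For \<open>\<alpha> < 1\<close> the quantity \<open>B\<^sup>2 A\<^bsup>-2(1-\<alpha>)/(2-\<alpha>)\<^esup>\<close>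
is also constant and, \<open>f'\<close> being bounded, it tends to \<open>0\<close>; hence \<open>B = 0\<close>. In all cases
\<open>(2 - \<alpha>) A f' sin \<phi> < 2A\<^sup>2\<close>, which says that the Wronskian of \<open>A\<close> with the solution \<open>1 - z\<^sup>2\<close>,
\<open>z = cos \<phi>\<close>, of Legendre's equation \<open>(1 - z\<^sup>2) A'' + 2A = 0\<close> is strictly monotone. This
contradicts its signs at the end points. So \<open>a = 0\<close>, whence \<open>f = 0\<close> by incompressibility, and then
\<open>p sin\<^bsup>2\<alpha>\<^esup> \<phi>\<close> is constant, which forces \<open>p = b = 0\<close>.
\<close>

subsection \<open>The reduced system of ordinary differential equations\<close>

text \<open>The transport equation says that \<open>h x * A x powr \<kappa>\<close> has zero
  derivative, so on the interval it equals its limit at \<open>s\<close>. The exponent may be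
  negative, as it is in the swirl argument.\<close>

lemma transport_zero:
  fixes A h :: "real \<Rightarrow> real"
  assumes DA: "\<And>x. s < x \<Longrightarrow> x < t \<Longrightarrow> (A has_real_derivative A' x) (at x)"
    and Apos: "\<And>x. s < x \<Longrightarrow> x < t \<Longrightarrow> A x > 0"
    and Dh: "\<And>x. s < x \<Longrightarrow> x < t \<Longrightarrow> (h has_real_derivative h' x) (at x)"
    and transport: "\<And>x. s < x \<Longrightarrow> x < t \<Longrightarrow> A x * h' x = - \<kappa> * A' x * h x"
    and lim: "((\<lambda>x. h x * A x powr \<kappa>) \<longlongrightarrow> 0) (at_right s)"
    and y: "s < y" "y < t"
  shows "h y = 0"
proof -
  let ?g = "\<lambda>x. h x * A x powr \<kappa>"
  have D: "(?g has_real_derivative 0) (at x)" if x: "x \<in> {s<..<t}" for x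
  proof -
    have "A x > 0" using Apos x by auto
    have "(?g has_real_derivative
        h' x * A x powr \<kappa> + \<kappa> * A x powr (\<kappa> - 1) * A' x * h x) (at x)"
      using x \<open>A x > 0\<close>
      by (auto intro!: derivative_eq_intros DA Dh has_real_derivative_powr simp: powr_diff)
    moreover have "h' x * A x powr \<kappa> + \<kappa> * A x powr (\<kappa> - 1) * A' x * h x =
        A x powr (\<kappa> - 1) * (A x * h' x + \<kappa> * A' x * h x)"
      using \<open>A x > 0\<close> by (simp add: powr_diff field_simps)
    ultimately show ?thesis using transport[of x] x by simp
  qed
  have const: "?g x = ?g y" if "x \<in> {s<..<t}" for x
    using has_field_derivative_zero_constant[of "{s<..<t}" ?g] D that y
    by (metis (no_types, lifting) convex_real_interval(8) greaterThanLessThan_iff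
        has_field_derivative_at_within)
  have "\<forall>\<^sub>F x in at_right s. x \<in> {s<..<t}"
    using y by (intro eventually_at_right_real) auto
  then have "\<forall>\<^sub>F x in at_right s. ?g x = ?g y"
    by eventually_elim (rule const)
  then have "(?g \<longlongrightarrow> ?g y) (at_right s)"
    by (rule tendsto_eventually)
  then have "?g y = 0"
    using lim tendsto_unique trivial_limit_at_right_real by blast
  then show ?thesis using Apos[OF y] by simp
qed

text \<open>The Euler system along a great circle through both poles, parametrized by the whole line
  so that the coefficients are differentiable through the poles. The equations hold only between the
  poles, and a factor \<open>sin x\<close> replaces cotangents. Of the second order of regularity
  only \<open>cont_f'\<close> is recorded.\<close>

locale axisymmetric_ode =
  fixes \<alpha> :: real and a b f p a' b' f' p' :: "real \<Rightarrow> real"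
  assumes alpha: "0 < \<alpha>" "\<alpha> < 2"
    and Da: "\<And>x. (a has_real_derivative a' x) (at x)"
    and Db: "\<And>x. (b has_real_derivative b' x) (at x)"
    and Df: "\<And>x. (f has_real_derivative f' x) (at x)"
    and Dp: "\<And>x. (p has_real_derivative p' x) (at x)"
    and cont_f': "\<And>x. isCont f' x"
    and divergence_eq: "\<And>x. 0 < x \<Longrightarrow> x < pi \<Longrightarrow>
      (2 - \<alpha>) * f x * sin x + a' x * sin x + a x * cos x = 0"
    and radial_eq: "\<And>x. 0 < x \<Longrightarrow> x < pi \<Longrightarrow>
      a x * f' x = (a x)\<^sup>2 + (b x)\<^sup>2 + \<alpha> * (f x)\<^sup>2 + 2 * \<alpha> * p x"
    and polar_eq: "\<And>x. 0 < x \<Longrightarrow> x < pi \<Longrightarrow>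
      ((1 - \<alpha>) * f x * a x + a x * a' x + p' x) * sin x = (b x)\<^sup>2 * cos x"
    and azimuthal_eq: "\<And>x. 0 < x \<Longrightarrow> x < pi \<Longrightarrow>
      ((1 - \<alpha>) * f x * b x + a x * b' x) * sin x + a x * b x * cos x = 0"
begin

section \<open>Quantities transported by the flow\<close>

lemma continuous: "isCont a x" "isCont b x" "isCont f x" "isCont p x"
  using DERIV_isCont Da Db Df Dp by blast+

text \<open>On the unit sphere, \<open>A\<close> is a constant multiple of the Stokes stream
  function, \<open>B\<close> the angular momentum about the axis and \<open>H\<close> twice the
  Bernoulli function.\<close>

definition A :: "real \<Rightarrow> real" where "A x = a x * sin x"
definition B :: "real \<Rightarrow> real" where "B x = b x * sin x"
definition H :: "real \<Rightarrow> real" where "H x = (a x)\<^sup>2 + (b x)\<^sup>2 + (f x)\<^sup>2 + 2 * p x"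

lemma continuous_A: "isCont A x"
  unfolding A_def by (intro continuous_intros continuous isCont_sin)

lemma continuous_H: "isCont H x"
  unfolding H_def by (intro continuous_intros continuous)

lemma DERIV_A:
  assumes "0 < x" "x < pi"
  shows "(A has_real_derivative - (2 - \<alpha>) * f x * sin x) (at x)"
proof -
  have "(A has_real_derivative a' x * sin x + cos x * a x) (at x)"
    unfolding A_def[abs_def] by (auto intro!: derivative_eq_intros Da)
  moreover have "a' x * sin x + cos x * a x = - (2 - \<alpha>) * f x * sin x"
    using divergence_eq[OF assms] by algebra
  ultimately show ?thesis by simp
qed

text \<open>The Bernoulli function is constant along streamlines and homogeneous of degree
  -2\<alpha>, so \<open>A * H'\<close> equals \<open>2 * \<alpha> * f * sin * H\<close>. Comparison
  with \<open>DERIV_A\<close> gives the exponent \<open>\<kappa>\<close>. It is positive and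
  \<open>H\<close> is continuous, so the product tends to 0 where \<open>A\<close> does.\<close>

lemma bernoulli_zero:
  assumes st: "0 \<le> s" "t \<le> pi" and As: "A s = 0"
    and pos: "\<And>x. s < x \<Longrightarrow> x < t \<Longrightarrow> A x > 0" and y: "s < y" "y < t"
  shows "H y = 0"
proof (rule transport_zero[OF _ pos _ _ _ y])
  define H' where "H' x = 2 * a x * a' x + 2 * b x * b' x + 2 * f x * f' x + 2 * p' x" for x
  define \<kappa> where "\<kappa> = 2 * \<alpha> / (2 - \<alpha>)"
  have kpos: "\<kappa> > 0" using alpha by (simp add: \<kappa>_def)
  show "(A has_real_derivative - (2 - \<alpha>) * f x * sin x) (at x)" if "s < x" "x < t" for x
    using that st by (intro DERIV_A) auto
  show "(H has_real_derivative H' x) (at x)" for x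
    unfolding H_def[abs_def] H'_def
    by (auto intro!: derivative_eq_intros Da Db Df Dp)
  show "A x * H' x = - \<kappa> * (- (2 - \<alpha>) * f x * sin x) * H x" if "s < x" "x < t" for x
  proof -
    have x: "0 < x" "x < pi" using that st by auto
    \<comment> \<open>Add 2a times the polar, 2b times the azimuthal and 2f sin x times the radial
      equation; the terms with \<open>cos x\<close> cancel.\<close>
    have "A x * H' x = 2 * \<alpha> * f x * sin x * H x"
      using radial_eq[OF x] polar_eq[OF x] azimuthal_eq[OF x]
      unfolding A_def H'_def H_def by algebra
    moreover have "\<kappa> * (2 - \<alpha>) = 2 * \<alpha>" using alpha by (simp add: \<kappa>_def)
    ultimately show ?thesis by algebra
  qed
  have "((\<lambda>x. A x powr \<kappa>) \<longlongrightarrow> 0) (at_right s)"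
  proof (rule tendsto_zero_powrI)
    show "(A \<longlongrightarrow> 0) (at_right s)"
      using continuous_A[of s] As by (auto simp: isCont_def filterlim_at_split)
    show "\<forall>\<^sub>F x in at_right s. 0 \<le> A x"
      using y pos by (auto simp: eventually_at_right intro!: exI[of _ t] less_imp_le)
  qed (use kpos in auto)
  moreover have "(H \<longlongrightarrow> H s) (at_right s)"
    using continuous_H[of s] by (auto simp: isCont_def filterlim_at_split)
  ultimately show "((\<lambda>x. H x * A x powr \<kappa>) \<longlongrightarrow> 0) (at_right s)"
    using tendsto_mult by fastforce
qed

text \<open>Vanishing of \<open>H\<close> turns the terms in \<open>f\<close> and \<open>p\<close>
  of the radial equation into -\<alpha> times \<open>(a y)\<^sup>2 + (b y)\<^sup>2\<close>; the
  result is multiplied by \<open>(sin y)\<^sup>2\<close>.\<close>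

lemma A_f':
  assumes st: "0 \<le> s" "t \<le> pi" and As: "A s = 0"
    and pos: "\<And>x. s < x \<Longrightarrow> x < t \<Longrightarrow> A x > 0" and y: "s < y" "y < t"
  shows "A y * f' y * sin y = (1 - \<alpha>) * ((A y)\<^sup>2 + (B y)\<^sup>2)"
proof -
  have x: "0 < y" "y < pi" using y st by auto
  show ?thesis
    using bernoulli_zero[OF assms] radial_eq[OF x] unfolding A_def B_def H_def by algebra
qed

text \<open>Angular momentum is transported too, but with a negative exponent, so vanishing of
  \<open>A\<close> at \<open>s\<close> does not suffice. For \<alpha> < 1, \<open>A_f'\<close>
  bounds \<open>(B x)\<^sup>2\<close> by a bounded factor times \<open>A x\<close>, and a positive
  power of \<open>A\<close> survives. This bound is the reason for working with the square of
  \<open>B\<close>.\<close>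

lemma swirl_zero:
  assumes "\<alpha> < 1" and st: "0 \<le> s" "t \<le> pi" and As: "A s = 0"
    and pos: "\<And>x. s < x \<Longrightarrow> x < t \<Longrightarrow> A x > 0" and y: "s < y" "y < t"
  shows "B y = 0"
proof -
  define B' where "B' x = b' x * sin x + b x * cos x" for x
  \<comment> \<open>The ratio of the degrees in the radius of angular momentum and stream function.
    The power left over is 1 - 2\<gamma> = \<alpha>/(2 - \<alpha>) > 0.\<close>
  define \<gamma> where "\<gamma> = (1 - \<alpha>) / (2 - \<alpha>)"
  have g: "\<gamma> * (2 - \<alpha>) = 1 - \<alpha>" using alpha by (simp add: \<gamma>_def)
  have g2: "2 * \<gamma> < 1" using alpha by (simp add: \<gamma>_def field_simps)
  have "(B y)\<^sup>2 = 0"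
  proof (rule transport_zero[OF _ pos _ _ _ y])
    show "(A has_real_derivative - (2 - \<alpha>) * f x * sin x) (at x)" if "s < x" "x < t" for x
      using that st by (intro DERIV_A) auto
    show "((\<lambda>x. (B x)\<^sup>2) has_real_derivative 2 * B x * B' x) (at x)" for x
      unfolding B_def[abs_def] B'_def
      by (auto intro!: derivative_eq_intros Db)
    show "A x * (2 * B x * B' x) = - (- 2 * \<gamma>) * (- (2 - \<alpha>) * f x * sin x) * (B x)\<^sup>2"
      if "s < x" "x < t" for x
    proof -
      have x: "0 < x" "x < pi" using that st by auto
      show ?thesis
        using azimuthal_eq[OF x] g unfolding A_def B'_def B_def by algebra
    qed
    have "((\<lambda>x. A x powr (1 - 2 * \<gamma>)) \<longlongrightarrow> 0) (at_right s)"
    proof (rule tendsto_zero_powrI)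
      show "(A \<longlongrightarrow> 0) (at_right s)"
        using continuous_A[of s] As by (auto simp: isCont_def filterlim_at_split)
      show "\<forall>\<^sub>F x in at_right s. 0 \<le> A x"
        using y pos by (auto simp: eventually_at_right intro!: exI[of _ t] less_imp_le)
    qed (use g2 in auto)
    \<comment> \<open>Continuity of \<open>f'\<close> at \<open>s\<close> enters here, also when
      \<open>s\<close> is a pole.\<close>
    moreover have "((\<lambda>x. f' x * sin x / (1 - \<alpha>)) \<longlongrightarrow> f' s * sin s / (1 - \<alpha>)) (at_right s)"
      using isCont_mult[OF cont_f' isCont_sin, of s] \<open>\<alpha> < 1\<close>
      by (intro tendsto_divide) (auto simp: isCont_def filterlim_at_split)
    ultimately have lim: "((\<lambda>x. f' x * sin x / (1 - \<alpha>) * A x powr (1 - 2 * \<gamma>)) \<longlongrightarrow> 0) (at_right s)"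
      using tendsto_mult by fastforce
    have ev: "\<forall>\<^sub>F x in at_right s. s < x \<and> x < t"
      using y by (auto simp: eventually_at_right intro!: exI[of _ t])
    show "((\<lambda>x. (B x)\<^sup>2 * A x powr (- 2 * \<gamma>)) \<longlongrightarrow> 0) (at_right s)"
    proof (rule tendsto_sandwich[OF _ _ tendsto_const lim])
      show "\<forall>\<^sub>F x in at_right s. 0 \<le> (B x)\<^sup>2 * A x powr (- 2 * \<gamma>)"
        by simp
      show "\<forall>\<^sub>F x in at_right s. (B x)\<^sup>2 * A x powr (- 2 * \<gamma>)
          \<le> f' x * sin x / (1 - \<alpha>) * A x powr (1 - 2 * \<gamma>)"
        using ev
      proof eventually_elim
        case (elim x)
        then have "A x > 0" using pos by auto
        have "(1 - \<alpha>) * (B x)\<^sup>2 \<le> (1 - \<alpha>) * ((A x)\<^sup>2 + (B x)\<^sup>2)"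
          using \<open>\<alpha> < 1\<close> by simp
        also have "\<dots> = A x * f' x * sin x"
          using A_f'[OF st As pos] elim by simp
        finally have "(B x)\<^sup>2 \<le> f' x * sin x / (1 - \<alpha>) * A x"
          using \<open>\<alpha> < 1\<close> by (simp add: field_simps)
        then have "(B x)\<^sup>2 * A x powr (- 2 * \<gamma>) \<le> f' x * sin x / (1 - \<alpha>) * A x * A x powr (- 2 * \<gamma>)"
          by (intro mult_right_mono) auto
        also have "\<dots> = f' x * sin x / (1 - \<alpha>) * A x powr (1 - 2 * \<gamma>)"
          using \<open>A x > 0\<close> powr_add[of "A x" 1 "- 2 * \<gamma>"] by simp
        finally show ?case .
      qed
    qed
  qed
  then show ?thesis by simp
qed

section \<open>Sturm comparison and the vanishing of the flow\<close>

text \<open>The Wronskian \<open>\<Phi>\<close> decreases strictly from \<open>s\<close> to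
  \<open>t\<close>. But \<open>A\<close> leaves 0 upwards at \<open>s\<close> and comes back to 0 at
  \<open>t\<close>, which forces \<open>\<Phi> s \<le> 0 \<le> \<Phi> t\<close>.\<close>

lemma no_positive_interval:
  assumes st: "0 \<le> s" "s < t" "t \<le> pi" and As: "A s = 0" and At: "A t = 0"
    and pos: "\<And>x. s < x \<Longrightarrow> x < t \<Longrightarrow> A x > 0"
  shows False
proof -
  \<comment> \<open>the Wronskian, with \<open>dA/dz = (2 - \<alpha>) f\<close>\<close>
  define \<Phi> where "\<Phi> x = (2 - \<alpha>) * f x * (sin x)\<^sup>2 + 2 * cos x * A x" for x
  have "\<Phi> t < \<Phi> s"
  proof (rule DERIV_neg_imp_decreasing_open[OF \<open>s < t\<close>])
    show "continuous_on {s..t} \<Phi>"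
      unfolding \<Phi>_def using continuous continuous_A
      by (intro continuous_at_imp_continuous_on ballI continuous_intros) auto
    fix x assume x: "s < x" "x < t"
    then have x': "0 < x" "x < pi" using st by auto
    have sin: "sin x > 0" using x' by (rule sin_gt_zero)
    have "(\<Phi> has_real_derivative (2 - \<alpha>) * f' x * (sin x)\<^sup>2 - 2 * sin x * A x) (at x)"
      unfolding \<Phi>_def
      by (auto intro!: derivative_eq_intros Df DERIV_A x' simp: power2_eq_square algebra_simps)
    \<comment> \<open>Dividing by \<open>sin x\<close> and multiplying by \<open>A x\<close>, both
      positive, produces the expression evaluated by \<open>A_f'\<close>.\<close>
    moreover have "(2 - \<alpha>) * f' x * (sin x)\<^sup>2 - 2 * sin x * A x < 0"
    proof -
      have eq: "A x * f' x * sin x = (1 - \<alpha>) * ((A x)\<^sup>2 + (B x)\<^sup>2)"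
        using A_f'[OF st(1,3) As pos x] .
      have Ax: "A x > 0" using pos x by simp
      \<comment> \<open>For \<alpha> < 1 the swirl is gone and (2 - \<alpha>)(1 - \<alpha>) < 2
        because \<alpha> > 0. For \<alpha> \<ge> 1 the factor 1 - \<alpha> makes the left side
        nonpositive, whatever the swirl.\<close>
      have "(2 - \<alpha>) * (A x * f' x * sin x) < 2 * (A x)\<^sup>2"
      proof (cases "\<alpha> < 1")
        case True
        then have "B x = 0" using swirl_zero[OF _ st(1,3) As pos x] by simp
        then have "(2 - \<alpha>) * (A x * f' x * sin x) = ((2 - \<alpha>) * (1 - \<alpha>)) * (A x)\<^sup>2"
          unfolding eq by simp
        moreover have "(2 - \<alpha>) * (1 - \<alpha>) < 2 * 1"
          using True alpha by (intro mult_strict_mono) auto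
        ultimately show ?thesis using Ax by (simp only: mult_strict_right_mono zero_less_power)
      next
        case False
        then have "(2 - \<alpha>) * (A x * f' x * sin x) \<le> 0"
          unfolding eq using alpha
          by (intro mult_nonneg_nonpos mult_nonpos_nonneg) auto
        also have "0 < 2 * (A x)\<^sup>2" using Ax by simp
        finally show ?thesis .
      qed
      then have "A x * ((2 - \<alpha>) * f' x * sin x - 2 * A x) < 0"
        by (simp add: algebra_simps power2_eq_square)
      then have "(2 - \<alpha>) * f' x * sin x - 2 * A x < 0"
        using Ax by (simp add: mult_less_0_iff)
      then have "sin x * ((2 - \<alpha>) * f' x * sin x - 2 * A x) < 0"
        by (rule mult_pos_neg[OF sin])
      then show ?thesis by (simp add: algebra_simps power2_eq_square)
    qed
    ultimately show "\<exists>y. (\<Phi> has_real_derivative y) (at x) \<and> y < 0" by blast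
  qed
  \<comment> \<open>At a pole \<open>\<Phi>\<close> vanishes with the sine. Elsewhere only the term
    with \<open>f s\<close> remains, and \<open>f s > 0\<close> would make \<open>A\<close> negative
    just after \<open>s\<close>. The end \<open>t\<close> is symmetric.\<close>
  moreover have "\<Phi> s \<le> 0"
  proof (cases "s = 0")
    case False
    then have s: "0 < s" "s < pi" using st by auto
    have "f s \<le> 0"
    proof (rule ccontr)
      assume "\<not> f s \<le> 0"
      then have "- (2 - \<alpha>) * f s * sin s < 0"
        using alpha sin_gt_zero[OF s] by (intro mult_neg_pos) auto
      then obtain d where d: "d > 0" "\<And>h. h > 0 \<Longrightarrow> h < d \<Longrightarrow> A (s + h) < A s"
        using DERIV_neg_dec_right[OF DERIV_A[OF s]] by blast
      define e where "e = min (d/2) ((t - s)/2)"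
      have "0 < e" "e < d" "e < t - s" using d(1) st by (auto simp: e_def min_def field_simps)
      then show False using d(2)[of e] pos[of "s + e"] As by auto
    qed
    then show ?thesis using As alpha by (simp add: \<Phi>_def mult_nonneg_nonpos mult_nonpos_nonneg)
  qed (use As in \<open>simp add: \<Phi>_def\<close>)
  moreover have "\<Phi> t \<ge> 0"
  proof (cases "t = pi")
    case False
    then have t: "0 < t" "t < pi" using st by auto
    have "f t \<ge> 0"
    proof (rule ccontr)
      assume "\<not> f t \<ge> 0"
      then have "- (2 - \<alpha>) * f t * sin t > 0"
        using alpha sin_gt_zero[OF t] by (intro mult_pos_pos mult_neg_neg) auto
      then obtain d where d: "d > 0" "\<And>h. h > 0 \<Longrightarrow> h < d \<Longrightarrow> A (t - h) < A t"
        using DERIV_pos_inc_left[OF DERIV_A[OF t]] by blast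
      define e where "e = min (d/2) ((t - s)/2)"
      have "0 < e" "e < d" "e < t - s" using d(1) st by (auto simp: e_def min_def field_simps)
      then show False using d(2)[of e] pos[of "t - e"] At by auto
    qed
    then show ?thesis using At alpha by (simp add: \<Phi>_def)
  qed (use At in \<open>simp add: \<Phi>_def\<close>)
  ultimately show False by simp
qed

text \<open>If \<open>a x > 0\<close>, the zeros of \<open>A\<close> nearest to \<open>x\<close> on
  either side bound an interval excluded by \<open>no_positive_interval\<close>. Such zeros exist
  because the sine vanishes at both poles.\<close>

lemma a_nonpos:
  assumes x: "0 < x" "x < pi"
  shows "a x \<le> 0"
proof (rule ccontr)
  assume "\<not> a x \<le> 0"
  then have Ax: "A x > 0" using sin_gt_zero[OF x] by (simp add: A_def)
  have contA: "continuous_on S A" for S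
    using continuous_A by (simp add: continuous_at_imp_continuous_on)
  have compact: "compact {y \<in> {c..d}. A y = 0}" for c d
  proof -
    have "closed ({c..d} \<inter> A -` {0})"
      using contA by (intro continuous_closed_preimage) auto
    then have "compact ({c..d} \<inter> ({c..d} \<inter> A -` {0}))"
      by (intro compact_Int_closed) auto
    moreover have "{c..d} \<inter> ({c..d} \<inter> A -` {0}) = {y \<in> {c..d}. A y = 0}" by auto
    ultimately show ?thesis by simp
  qed
  have "0 \<in> {y \<in> {0..x}. A y = 0}" "pi \<in> {y \<in> {x..pi}. A y = 0}"
    using x by (auto simp: A_def)
  then have ne: "{y \<in> {0..x}. A y = 0} \<noteq> {}" "{y \<in> {x..pi}. A y = 0} \<noteq> {}"
    by blast+
  obtain s where s: "0 \<le> s" "s \<le> x" "A s = 0" "\<And>y. 0 \<le> y \<Longrightarrow> y \<le> x \<Longrightarrow> A y = 0 \<Longrightarrow> y \<le> s"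
    using compact_attains_sup[OF compact[of 0 x] ne(1)] by auto
  obtain t where t: "x \<le> t" "t \<le> pi" "A t = 0" "\<And>y. x \<le> y \<Longrightarrow> y \<le> pi \<Longrightarrow> A y = 0 \<Longrightarrow> t \<le> y"
    using compact_attains_inf[OF compact[of x pi] ne(2)] by auto
  show False
  proof (rule no_positive_interval[OF s(1) _ t(2) s(3) t(3)])
    show "s < t" using s(2,3) t(1,3) Ax by (cases "s = x") auto
    fix y assume y: "s < y" "y < t"
    show "A y > 0"
    proof (rule ccontr)
      assume neg: "\<not> A y > 0"
      show False
      proof (cases "y \<le> x")
        case True
        then obtain z where "y \<le> z" "z \<le> x" "A z = 0"
          using IVT'[of A y 0 x] neg Ax contA by auto
        then show False using s(4)[of z] s(1) y by auto
      next
        case False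
        then obtain z where "x \<le> z" "z \<le> y" "A z = 0"
          using IVT2'[of A y 0 x] neg Ax contA by auto
        then show False using t(4)[of z] t(2) y by auto
      qed
    qed
  qed
qed

text \<open>Flow reversal: the momentum equation is quadratic in the velocity, so V may be replaced
  by -V with the same pressure. This turns the upper bound on \<open>a\<close> into a lower
  one.\<close>

lemma reversed: "axisymmetric_ode \<alpha> (\<lambda>x. - a x) (\<lambda>x. - b x) (\<lambda>x. - f x) p
    (\<lambda>x. - a' x) (\<lambda>x. - b' x) (\<lambda>x. - f' x) p'"
proof
  show "isCont (\<lambda>x. - f' x) x" for x by (intro continuous_intros cont_f')
  show "(2 - \<alpha>) * - f x * sin x + - a' x * sin x + - a x * cos x = 0" if "0 < x" "x < pi" for x
    using divergence_eq[OF that] by algebra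
  show "((1 - \<alpha>) * - f x * - b x + - a x * - b' x) * sin x + - a x * - b x * cos x = 0"
    if "0 < x" "x < pi" for x
    using azimuthal_eq[OF that] by simp
qed (use alpha in \<open>auto intro!: DERIV_minus Da Db Df Dp radial_eq polar_eq\<close>)

lemma a_zero:
  assumes "0 < x" "x < pi"
  shows "a x = 0"
  using a_nonpos[OF assms] axisymmetric_ode.a_nonpos[OF reversed assms] by simp

lemma f_zero:
  assumes x: "0 < x" "x < pi"
  shows "f x = 0"
proof -
  have "(a has_real_derivative 0) (at x)"
    using x by (intro has_field_derivative_transform_within_open[OF DERIV_const, of "{0<..<pi}"])
      (auto simp: a_zero)
  then have "a' x = 0" using Da DERIV_unique by blast
  then show ?thesis using divergence_eq[OF x] a_zero[OF x] sin_gt_zero[OF x] alpha by simp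
qed

text \<open>With \<open>a\<close> and \<open>f\<close> gone, the radial equation gives b^2 =
  -2\<alpha>p, and the polar one becomes a transport equation for \<open>p\<close> with
  \<open>sin\<close> in the role of \<open>A\<close>. The limit is taken at the pole 0.\<close>

lemma p_zero:
  assumes x: "0 < x" "x < pi"
  shows "p x = 0"
proof (rule transport_zero[where A = sin and s = 0 and t = pi and A' = cos and \<kappa> = "2 * \<alpha>", OF _ _ Dp])
  show "sin x * p' x = - (2 * \<alpha>) * cos x * p x" if "0 < x" "x < pi" for x
    using radial_eq[OF that] polar_eq[OF that] a_zero[OF that] f_zero[OF that]
    by simp algebra
  have "((\<lambda>x. sin x powr (2 * \<alpha>)) \<longlongrightarrow> 0) (at_right 0)"
  proof (rule tendsto_zero_powrI)
    show "(sin \<longlongrightarrow> (0::real)) (at_right 0)"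
      using isCont_sin[of "0::real"] by (simp add: isCont_def filterlim_at_split)
    show "\<forall>\<^sub>F x in at_right (0::real). 0 \<le> sin x"
      using eventually_at_right_real[OF pi_gt_zero]
      by eventually_elim (auto intro!: sin_ge_zero)
    show "((\<lambda>x. 2 * \<alpha>) \<longlongrightarrow> 2 * \<alpha>) (at_right 0)" by simp
  qed (use alpha in auto)
  moreover have "(p \<longlongrightarrow> p 0) (at_right 0)"
    using continuous(4)[of 0] by (auto simp: isCont_def filterlim_at_split)
  ultimately show "((\<lambda>x. p x * sin x powr (2 * \<alpha>)) \<longlongrightarrow> 0) (at_right 0)"
    using tendsto_mult by fastforce
qed (use x in \<open>auto intro: sin_gt_zero DERIV_sin\<close>)

lemma zero:
  assumes "0 \<le> x" "x \<le> pi"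
  shows "a x = 0" "b x = 0" "f x = 0"
proof -
  have b_zero: "b y = 0" if "0 < y" "y < pi" for y
    using radial_eq[OF that] a_zero[OF that] f_zero[OF that] p_zero[OF that] by simp
  \<comment> \<open>The poles, where the system says nothing, are reached by continuity.\<close>
  have extend: "g x = 0" if "\<And>y. isCont g y" "\<And>y. 0 < y \<Longrightarrow> y < pi \<Longrightarrow> g y = 0" for g :: "real \<Rightarrow> real"
    using continuous_constant_on_closure[of "{0<..<pi}" g 0 x] that assms
    by (simp add: closure_greaterThanLessThan continuous_at_imp_continuous_on)
  show "a x = 0" "b x = 0" "f x = 0"
    using extend continuous a_zero b_zero f_zero by simp_all
qed

end

subsection \<open>Orthonormal frames and spherical coordinates\<close>

text \<open>The trace is invariant under conjugation by the orthogonal matrix whose columns are the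
  \<open>u i\<close>.\<close>

lemma trace_orthonormal:
  fixes M :: "real^'n^'n" and u :: "'n \<Rightarrow> real^'n"
  assumes "\<And>i j. u i \<bullet> u j = (if i = j then 1 else 0)"
  shows "trace M = (\<Sum>i\<in>UNIV. u i \<bullet> (M *v u i))"
proof -
  define U :: "real^'n^'n" where "U = (\<chi> i j. u j $ i)"
  have "transpose U ** U = mat 1"
    using assms by (simp add: U_def transpose_def matrix_matrix_mult_def mat_def vec_eq_iff inner_vec_def)
  then have "U ** transpose U = mat 1"
    using matrix_left_right_inverse by blast
  then have "trace M = trace (M ** (U ** transpose U))"
    by simp
  also have "\<dots> = trace (transpose U ** (M ** U))"
    by (metis matrix_mul_assoc trace_mul_sym)
  also have "\<dots> = (\<Sum>i\<in>UNIV. u i \<bullet> (M *v u i))"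
    by (simp add: trace_def U_def transpose_def matrix_matrix_mult_def inner_vec_def matrix_vector_mult_def)
  finally show ?thesis .
qed

lemma trace_orthonormal_3:
  fixes M :: "real^3^3" and u v w :: "real^3"
  assumes "norm u = 1" "norm v = 1" "norm w = 1" "u \<bullet> v = 0" "u \<bullet> w = 0" "v \<bullet> w = 0"
  shows "trace M = u \<bullet> (M *v u) + v \<bullet> (M *v v) + w \<bullet> (M *v w)"
proof -
  let ?f = "\<lambda>i::3. if i = 1 then u else if i = 2 then v else w"
  have "\<forall>i j. ?f i \<bullet> ?f j = (if i = j then 1 else 0)"
    using assms by (simp add: forall_3 inner_commute norm_eq_1)
  then show ?thesis
    by (subst trace_orthonormal[of ?f]) (simp_all add: sum_3)
qed

text \<open>\<open>Ck_on\<close> controls the derivative only in each fixed direction. Since the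
  direction moves with \<open>s\<close>, it is expanded in the standard basis.\<close>

lemma isCont_frechet_derivative_along:
  fixes G :: "'a::euclidean_space \<Rightarrow> real"
  assumes G: "Ck_on 2 G U" and U: "open U" "\<gamma> t \<in> U" and \<gamma>: "isCont \<gamma> t" "isCont \<gamma>' t"
  shows "isCont (\<lambda>s. frechet_derivative G (at (\<gamma> s)) (\<gamma>' s)) t"
proof -
  have diff: "G differentiable at x" if "x \<in> U" for x
    using G that by (simp add: numeral_2_eq_2)
  have cont: "isCont (\<lambda>x. frechet_derivative G (at x) h) x" if "x \<in> U" for x h
    using G that by (auto simp: numeral_2_eq_2 intro: differentiable_imp_continuous_within)
  have "isCont (\<lambda>s. \<Sum>i\<in>Basis. (\<gamma>' s \<bullet> i) * frechet_derivative G (at (\<gamma> s)) i) t"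
    using U \<gamma> by (intro continuous_intros isCont_o2[OF \<gamma>(1)] cont) auto
  moreover have "\<forall>\<^sub>F s in nhds t. \<gamma> s \<in> U"
    using \<gamma>(1) U by (simp add: isCont_def tendsto_at_iff_tendsto_nhds topological_tendstoD)
  then have "\<forall>\<^sub>F s in nhds t. frechet_derivative G (at (\<gamma> s)) (\<gamma>' s) =
      (\<Sum>i\<in>Basis. (\<gamma>' s \<bullet> i) * frechet_derivative G (at (\<gamma> s)) i)"
  proof eventually_elim
    case (elim s)
    interpret linear "frechet_derivative G (at (\<gamma> s))"
      by (rule linear_frechet_derivative[OF diff[OF elim]])
    have "frechet_derivative G (at (\<gamma> s)) (\<gamma>' s) =
        frechet_derivative G (at (\<gamma> s)) (\<Sum>i\<in>Basis. (\<gamma>' s \<bullet> i) *\<^sub>R i)"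
      by (simp add: euclidean_representation)
    also have "\<dots> = (\<Sum>i\<in>Basis. (\<gamma>' s \<bullet> i) * frechet_derivative G (at (\<gamma> s)) i)"
      by (simp add: sum scale)
    finally show ?case .
  qed
  ultimately show ?thesis
    using isCont_cong by fast
qed

lemma has_vector_derivative_vector_3:
  assumes "(x has_real_derivative x') F" "(y has_real_derivative y') F" "(z has_real_derivative z') F"
  shows "((\<lambda>t. vector [x t, y t, z t] :: real^3) has_vector_derivative vector [x', y', z']) F"
proof -
  have eq: "(vector [r, s, t] :: real^3) = r *\<^sub>R axis 1 1 + s *\<^sub>R axis 2 1 + t *\<^sub>R axis 3 1" for r s t
    by (simp add: vec_eq_iff forall_3 axis_def)
  show ?thesis
    unfolding eq using assms[unfolded has_real_derivative_iff_has_vector_derivative]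
    by (intro has_vector_derivative_add bounded_linear.has_vector_derivative[OF bounded_linear_scaleR_left])
qed

section \<open>The moving frame of spherical coordinates\<close>

lemma frame_derivatives_phi:
  "((\<lambda>\<phi>. sph_point \<phi> \<theta>) has_vector_derivative e_phi \<phi> \<theta>) (at \<phi>)"
  "((\<lambda>\<phi>. e_phi \<phi> \<theta>) has_vector_derivative - sph_point \<phi> \<theta>) (at \<phi>)"
  "((\<lambda>\<phi>. e_theta \<phi> \<theta>) has_vector_derivative 0) (at \<phi>)"
  unfolding sph_point_def e_phi_def e_theta_def
  by (rule has_vector_derivative_eq_rhs, rule has_vector_derivative_vector_3,
      (rule derivative_eq_intros refl)+, simp add: vec_eq_iff forall_3)+

lemma frame_derivatives_theta:
  "((\<lambda>\<theta>. sph_point \<phi> \<theta>) has_vector_derivative sin \<phi> *\<^sub>R e_theta \<phi> \<theta>) (at \<theta>)"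
  "((\<lambda>\<theta>. e_phi \<phi> \<theta>) has_vector_derivative cos \<phi> *\<^sub>R e_theta \<phi> \<theta>) (at \<theta>)"
  "((\<lambda>\<theta>. e_theta \<phi> \<theta>) has_vector_derivative
      - (sin \<phi> *\<^sub>R sph_point \<phi> \<theta> + cos \<phi> *\<^sub>R e_phi \<phi> \<theta>)) (at \<theta>)"
proof -
  \<comment> \<open>For the third claim: the derivative of \<open>e_theta\<close> is the horizontal
    unit vector towards the axis, resolved along \<open>sph_point\<close> and
    \<open>e_phi\<close>.\<close>
  have "- (sin \<phi> * (sin \<phi> * z)) - cos \<phi> * (cos \<phi> * z) = - z" for z
    using sin_cos_squared_add[of \<phi>] by algebra
  then show "((\<lambda>\<theta>. sph_point \<phi> \<theta>) has_vector_derivative sin \<phi> *\<^sub>R e_theta \<phi> \<theta>) (at \<theta>)"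
    "((\<lambda>\<theta>. e_phi \<phi> \<theta>) has_vector_derivative cos \<phi> *\<^sub>R e_theta \<phi> \<theta>) (at \<theta>)"
    "((\<lambda>\<theta>. e_theta \<phi> \<theta>) has_vector_derivative
      - (sin \<phi> *\<^sub>R sph_point \<phi> \<theta> + cos \<phi> *\<^sub>R e_phi \<phi> \<theta>)) (at \<theta>)"
    unfolding sph_point_def e_phi_def e_theta_def
    by - (rule has_vector_derivative_eq_rhs, rule has_vector_derivative_vector_3,
      (rule derivative_eq_intros refl)+, simp add: vec_eq_iff forall_3)+
qed

lemma frame_inner:
  "sph_point \<phi> \<theta> \<bullet> sph_point \<phi> \<theta> = 1" "e_phi \<phi> \<theta> \<bullet> e_phi \<phi> \<theta> = 1"
  "e_theta \<phi> \<theta> \<bullet> e_theta \<phi> \<theta> = 1"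
  "sph_point \<phi> \<theta> \<bullet> e_phi \<phi> \<theta> = 0" "sph_point \<phi> \<theta> \<bullet> e_theta \<phi> \<theta> = 0"
  "e_phi \<phi> \<theta> \<bullet> e_theta \<phi> \<theta> = 0"
  using sin_cos_squared_add[of \<phi>] sin_cos_squared_add[of \<theta>]
  by (simp_all add: sph_point_def e_phi_def e_theta_def inner_vec_def sum_3; algebra)+

lemma frame_expansion:
  "y = (y \<bullet> e_phi \<phi> \<theta>) *\<^sub>R e_phi \<phi> \<theta> + (y \<bullet> e_theta \<phi> \<theta>) *\<^sub>R e_theta \<phi> \<theta>
    + (y \<bullet> sph_point \<phi> \<theta>) *\<^sub>R sph_point \<phi> \<theta>"
proof -
  note trig = sin_cos_squared_add[of \<phi>] sin_cos_squared_add[of \<theta>]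
  show ?thesis
    by (simp add: vec_eq_iff forall_3 sph_point_def e_phi_def e_theta_def inner_vec_def sum_3,
        intro conjI; use trig in algebra)
qed

lemma orthogonal_frame_expansion:
  fixes T :: "real^3 \<Rightarrow> real^3"
  assumes "orthogonal_transformation T"
  shows "y = (y \<bullet> T (e_phi \<phi> \<theta>)) *\<^sub>R T (e_phi \<phi> \<theta>) + (y \<bullet> T (e_theta \<phi> \<theta>)) *\<^sub>R T (e_theta \<phi> \<theta>)
    + (y \<bullet> T (sph_point \<phi> \<theta>)) *\<^sub>R T (sph_point \<phi> \<theta>)"
proof -
  have T: "linear T" "T x \<bullet> T y = x \<bullet> y" for x y
    using assms by (auto simp: orthogonal_transformation_def)
  obtain z where y: "y = T z"
    using orthogonal_transformation_surj[OF assms] by (rule surjE)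
  show ?thesis
    unfolding y T(2) by (subst frame_expansion[of z \<phi> \<theta>])
      (simp only: linear_add[OF T(1)] linear_scale[OF T(1)])
qed

lemma sphere_polar_coordinates:
  assumes "norm (y :: real^3) = 1"
  obtains \<phi> \<theta> where "0 \<le> \<phi>" "\<phi> \<le> pi" "y = sph_point \<phi> \<theta>"
proof -
  have sq: "(y$1)\<^sup>2 + (y$2)\<^sup>2 + (y$3)\<^sup>2 = 1"
    using assms by (simp add: norm_eq_1 inner_vec_def sum_3 power2_eq_square)
  define \<rho> where "\<rho> = sqrt ((y$1)\<^sup>2 + (y$2)\<^sup>2)"
  have \<rho>: "\<rho>\<^sup>2 = (y$1)\<^sup>2 + (y$2)\<^sup>2" "0 \<le> \<rho>" by (simp_all add: \<rho>_def)
  obtain \<phi> where \<phi>: "0 \<le> \<phi>" "\<phi> \<le> pi" "y$3 = cos \<phi>" "\<rho> = sin \<phi>"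
    using sincos_total_pi[of \<rho> "y$3"] sq \<rho> by auto
  obtain \<theta> where "y$1 = \<rho> * cos \<theta>" "y$2 = \<rho> * sin \<theta>"
  proof (cases "\<rho> = 0")
    case True
    \<comment> \<open>At a pole every longitude serves; 0 is taken.\<close>
    then show ?thesis using that[of 0] \<rho> by (simp add: sum_power2_eq_zero_iff)
  next
    case False
    then have "(y$1 / \<rho>)\<^sup>2 + (y$2 / \<rho>)\<^sup>2 = 1"
      by (simp add: power_divide \<rho>(1)[symmetric] flip: add_divide_distrib)
    then obtain \<theta> where "y$1 / \<rho> = cos \<theta>" "y$2 / \<rho> = sin \<theta>"
      by (rule sincos_total_2pi)
    then show ?thesis using that[of \<theta>] False by (simp add: field_simps)
  qed
  then show ?thesis
    using that[of \<phi> \<theta>] \<phi> by (simp add: sph_point_def vec_eq_iff forall_3)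
qed

section \<open>Homogeneity in the radius\<close>

lemma velocity_scaleR:
  assumes "r > 0"
  shows "velocity \<alpha> v f (r *\<^sub>R x) = r powr (- \<alpha>) *\<^sub>R velocity \<alpha> v f x"
  using assms by (simp add: velocity_def sgn_scaleR powr_mult powr_minus)

lemma pressure_scaleR:
  assumes "r > 0"
  shows "pressure \<alpha> p (r *\<^sub>R x) = r powr (- (2 * \<alpha>)) * pressure \<alpha> p x"
  using assms by (simp add: pressure_def sgn_scaleR powr_mult powr_minus field_simps)

text \<open>Euler's relation, by differentiating along the ray through \<open>x\<close> at
  \<open>r = 1\<close>.\<close>

lemma euler_homogeneous:
  fixes g :: "'a::real_normed_vector \<Rightarrow> 'b::real_normed_vector"
  assumes hom: "\<And>r. r > 0 \<Longrightarrow> g (r *\<^sub>R x) = r powr m *\<^sub>R g x"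
    and D: "(g has_derivative D) (at x)"
  shows "D x = m *\<^sub>R g x"
proof -
  have "((\<lambda>r. r *\<^sub>R x) has_vector_derivative x) (at 1)"
    by (auto intro!: derivative_eq_intros)
  then have "(g \<circ> (\<lambda>r. r *\<^sub>R x) has_vector_derivative D x) (at 1)"
    using D by (simp add: vector_derivative_diff_chain_within has_derivative_at_withinI)
  moreover have "((\<lambda>r. r powr m *\<^sub>R g x) has_vector_derivative m *\<^sub>R g x) (at 1)"
    by (auto intro!: derivative_eq_intros)
  then have "(g \<circ> (\<lambda>r. r *\<^sub>R x) has_vector_derivative m *\<^sub>R g x) (at 1)"
    by (rule has_vector_derivative_transform_within_open[of _ _ _ "{0<..}"]) (auto simp: hom)
  ultimately show ?thesis
    by (rule vector_derivative_unique_at)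
qed

subsection \<open>Reduction of the Euler equations\<close>

text \<open>In the frame \<open>n\<close>, \<open>u\<close>, \<open>w\<close> the derivative of
  \<open>V\<close> is found column by column: from homogeneity, along the meridian, and from
  rotational symmetry. The coefficients are inner products instead of \<open>a\<close>,
  \<open>b\<close>, \<open>F\<close>, \<open>Q\<close>, which axisymmetry leaves arbitrary outside
  the open interval.\<close>

lemma axisymmetric_solution_ode:
  fixes T :: "real^3 \<Rightarrow> real^3" and \<theta>\<^sub>0 :: real
  defines "n \<equiv> \<lambda>\<phi>. T (sph_point \<phi> \<theta>\<^sub>0)" and "u \<equiv> \<lambda>\<phi>. T (e_phi \<phi> \<theta>\<^sub>0)" and "w \<equiv> \<lambda>\<phi>. T (e_theta \<phi> \<theta>\<^sub>0)"
  assumes alpha: "0 < \<alpha>" "\<alpha> < 2" and sol: "Ck_solution 2 \<alpha> v f p"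
    and T: "orthogonal_transformation T"
    and sym: "\<And>\<phi> \<theta>. 0 < \<phi> \<Longrightarrow> \<phi> < pi \<Longrightarrow>
      v (T (sph_point \<phi> \<theta>)) = a \<phi> *\<^sub>R T (e_phi \<phi> \<theta>) + b \<phi> *\<^sub>R T (e_theta \<phi> \<theta>) \<and>
      f (T (sph_point \<phi> \<theta>)) = F \<phi> \<and> p (T (sph_point \<phi> \<theta>)) = Q \<phi>"
  defines "V \<equiv> velocity \<alpha> v f" and "P \<equiv> pressure \<alpha> p"
  shows "\<exists>a' b' f' p'. axisymmetric_ode \<alpha> (\<lambda>\<phi>. V (n \<phi>) \<bullet> u \<phi>) (\<lambda>\<phi>. V (n \<phi>) \<bullet> w \<phi>)
    (\<lambda>\<phi>. V (n \<phi>) \<bullet> n \<phi>) (\<lambda>\<phi>. P (n \<phi>)) a' b' f' p'"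
proof -
  have pt: "T (sph_point \<phi> \<theta>\<^sub>0) = n \<phi>" "T (e_phi \<phi> \<theta>\<^sub>0) = u \<phi>" "T (e_theta \<phi> \<theta>\<^sub>0) = w \<phi>" for \<phi>
    by (simp_all add: n_def u_def w_def)
  have lin: "linear T" and T_inner: "T x \<bullet> T y = x \<bullet> y" for x y
    using T by (auto simp: orthogonal_transformation_def)
  then interpret T: bounded_linear T by (simp add: linear_conv_bounded_linear)
  have norm_sph: "norm (T (sph_point \<phi> \<theta>)) = 1" for \<phi> \<theta>
    by (simp add: norm_eq_1 T_inner frame_inner)
  have V_sphere: "V y = v y + f y *\<^sub>R y" and P_sphere: "P y = p y" if "norm y = 1" for y
    using that by (simp_all add: V_def P_def velocity_def pressure_def sgn_div_norm)
  have ne0: "T (sph_point \<phi> \<theta>) \<noteq> 0" for \<phi> \<theta>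
    using norm_sph[of \<phi> \<theta>] by auto
  have euler: "stationary_euler_at V P (T (sph_point \<phi> \<theta>))" for \<phi> \<theta>
    using sol ne0 unfolding Ck_solution_def V_def P_def by blast
  define D where "D \<phi> h = jacobian V (at (n \<phi>)) *v h" for \<phi> h
  have D: "(V has_derivative D \<phi>) (at (n \<phi>))" for \<phi>
    using euler[of \<phi> \<theta>\<^sub>0] unfolding stationary_euler_at_def jacobian_works D_def pt by blast
  have D_linear: "linear (D \<phi>)" for \<phi>
    using D has_derivative_linear by blast
  have "\<exists>g. GDERIV P (n \<phi>) :> g \<and> D \<phi> (V (n \<phi>)) + g = 0" for \<phi>
    using euler[of \<phi> \<theta>\<^sub>0] unfolding stationary_euler_at_def advection_def D_def pt by blast
  then obtain g where
    gP: "GDERIV P (n \<phi>) :> g \<phi>" and mom: "D \<phi> (V (n \<phi>)) + g \<phi> = 0" for \<phi>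
    by metis
  have DP: "(P has_derivative (\<lambda>h. h \<bullet> g \<phi>)) (at (n \<phi>))" for \<phi>
    using gP by (simp add: gderiv_def)
  have inner [simp]:
    "n \<phi> \<bullet> n \<phi> = 1" "u \<phi> \<bullet> u \<phi> = 1" "w \<phi> \<bullet> w \<phi> = 1"
    "n \<phi> \<bullet> u \<phi> = 0" "n \<phi> \<bullet> w \<phi> = 0" "u \<phi> \<bullet> w \<phi> = 0"
    "u \<phi> \<bullet> n \<phi> = 0" "w \<phi> \<bullet> n \<phi> = 0" "w \<phi> \<bullet> u \<phi> = 0" for \<phi>
    unfolding n_def u_def w_def T_inner
    by (simp_all add: frame_inner inner_commute[of "e_phi _ _" "sph_point _ _"]
      inner_commute[of "e_theta _ _" "sph_point _ _"] inner_commute[of "e_theta _ _" "e_phi _ _"])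
  have Dn: "(n has_vector_derivative u \<phi>) (at \<phi>)"
    and Du: "(u has_vector_derivative - n \<phi>) (at \<phi>)"
    and Dw: "(w has_vector_derivative 0) (at \<phi>)" for \<phi>
    unfolding n_def u_def w_def
    using frame_derivatives_phi[of \<theta>\<^sub>0 \<phi>, THEN T.has_vector_derivative] by (simp_all add: T.neg T.zero)
  have DV: "((\<lambda>\<phi>. V (n \<phi>)) has_vector_derivative D \<phi> (u \<phi>)) (at \<phi>)" for \<phi>
    using vector_derivative_diff_chain_within[OF Dn, of V "D \<phi>" \<phi>] D[of \<phi>]
    by (simp add: o_def has_derivative_at_withinI)
  have DPn: "((\<lambda>\<phi>. P (n \<phi>)) has_real_derivative u \<phi> \<bullet> g \<phi>) (at \<phi>)" for \<phi>
    using vector_derivative_diff_chain_within[OF Dn, of P "\<lambda>h. h \<bullet> g \<phi>" \<phi>] DP[of \<phi>]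
    by (simp add: o_def has_derivative_at_withinI has_real_derivative_iff_has_vector_derivative)
  define A where "A \<phi> = V (n \<phi>) \<bullet> u \<phi>" for \<phi>
  define B where "B \<phi> = V (n \<phi>) \<bullet> w \<phi>" for \<phi>
  define f1 where "f1 \<phi> = V (n \<phi>) \<bullet> n \<phi>" for \<phi>
  \<comment> \<open>The correction terms come from the turning of the frame: n' = u, u' = -n, w' =
    0.\<close>
  define A' where "A' \<phi> = D \<phi> (u \<phi>) \<bullet> u \<phi> - f1 \<phi>" for \<phi>
  define B' where "B' \<phi> = D \<phi> (u \<phi>) \<bullet> w \<phi>" for \<phi>
  define f1' where "f1' \<phi> = D \<phi> (u \<phi>) \<bullet> n \<phi> + A \<phi>" for \<phi>
  have DA: "(A has_real_derivative A' \<phi>) (at \<phi>)"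
    and DB: "(B has_real_derivative B' \<phi>) (at \<phi>)"
    and Df: "(f1 has_real_derivative f1' \<phi>) (at \<phi>)" for \<phi>
    using bounded_bilinear.has_vector_derivative[OF bounded_bilinear_inner DV Du, of \<phi>]
      bounded_bilinear.has_vector_derivative[OF bounded_bilinear_inner DV Dw, of \<phi>]
      bounded_bilinear.has_vector_derivative[OF bounded_bilinear_inner DV Dn, of \<phi>]
    by (simp_all add: A_def[abs_def] B_def[abs_def] f1_def[abs_def] A'_def B'_def f1'_def
        has_real_derivative_iff_has_vector_derivative algebra_simps)
  have V_expand: "V (n \<phi>) = A \<phi> *\<^sub>R u \<phi> + B \<phi> *\<^sub>R w \<phi> + f1 \<phi> *\<^sub>R n \<phi>" for \<phi>
    unfolding A_def B_def f1_def n_def u_def w_def by (rule orthogonal_frame_expansion[OF T])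
  have D_ray: "D \<phi> (n \<phi>) = - \<alpha> *\<^sub>R V (n \<phi>)" for \<phi>
    using euler_homogeneous[where m = "- \<alpha>", OF _ D] by (simp add: V_def velocity_scaleR)
  have gP_ray: "n \<phi> \<bullet> g \<phi> = - 2 * \<alpha> * P (n \<phi>)" for \<phi>
    using euler_homogeneous[where m = "- (2 * \<alpha>)", OF _ DP] by (simp add: P_def pressure_scaleR)
  have coeffs: "A \<phi> = a \<phi>" "B \<phi> = b \<phi>" "f1 \<phi> = F \<phi>" "P (n \<phi>) = Q \<phi>" if "0 < \<phi>" "\<phi> < pi" for \<phi>
    using sym[OF that, of \<theta>\<^sub>0] V_sphere[OF norm_sph, of \<phi> \<theta>\<^sub>0] P_sphere[OF norm_sph, of \<phi> \<theta>\<^sub>0]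
    by (simp_all add: A_def B_def f1_def inner_left_distrib pt)
  have ring: "((\<lambda>\<theta>. T (sph_point \<phi> \<theta>)) has_vector_derivative sin \<phi> *\<^sub>R w \<phi>) (at \<theta>\<^sub>0)" for \<phi>
    using frame_derivatives_theta(1)[of \<phi> \<theta>\<^sub>0, THEN T.has_vector_derivative]
    by (simp add: w_def T.scaleR)
  \<comment> \<open>On a circle of latitude the coefficients are constant and only the frame turns;
    \<open>sin \<phi>\<close> is the speed of the circle in \<theta>.\<close>
  have D_w: "sin \<phi> *\<^sub>R D \<phi> (w \<phi>) = A \<phi> *\<^sub>R cos \<phi> *\<^sub>R w \<phi>
      - B \<phi> *\<^sub>R (sin \<phi> *\<^sub>R n \<phi> + cos \<phi> *\<^sub>R u \<phi>) + f1 \<phi> *\<^sub>R sin \<phi> *\<^sub>R w \<phi>" if \<phi>: "0 < \<phi>" "\<phi> < pi" for \<phi>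
  proof -
    have "((\<lambda>\<theta>. V (T (sph_point \<phi> \<theta>))) has_vector_derivative D \<phi> (sin \<phi> *\<^sub>R w \<phi>)) (at \<theta>\<^sub>0)"
      using vector_derivative_diff_chain_within[OF ring, of V "D \<phi>" \<phi>] D[of \<phi>]
      by (simp add: o_def has_derivative_at_withinI n_def)
    moreover have "V (T (sph_point \<phi> \<theta>)) =
        T (A \<phi> *\<^sub>R e_phi \<phi> \<theta> + B \<phi> *\<^sub>R e_theta \<phi> \<theta> + f1 \<phi> *\<^sub>R sph_point \<phi> \<theta>)" for \<theta>
      using V_sphere[OF norm_sph, of \<phi> \<theta>] sym[OF \<phi>, of \<theta>] coeffs[OF \<phi>] by (simp add: T.add T.scaleR)
    moreover have "((\<lambda>\<theta>. T (A \<phi> *\<^sub>R e_phi \<phi> \<theta> + B \<phi> *\<^sub>R e_theta \<phi> \<theta> + f1 \<phi> *\<^sub>R sph_point \<phi> \<theta>))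
        has_vector_derivative T (A \<phi> *\<^sub>R cos \<phi> *\<^sub>R e_theta \<phi> \<theta>\<^sub>0
          + B \<phi> *\<^sub>R (- (sin \<phi> *\<^sub>R sph_point \<phi> \<theta>\<^sub>0 + cos \<phi> *\<^sub>R e_phi \<phi> \<theta>\<^sub>0))
          + f1 \<phi> *\<^sub>R sin \<phi> *\<^sub>R e_theta \<phi> \<theta>\<^sub>0)) (at \<theta>\<^sub>0)"
      by (intro T.has_vector_derivative has_vector_derivative_add frame_derivatives_theta
        bounded_linear.has_vector_derivative[OF bounded_linear_scaleR_right])
    ultimately have "D \<phi> (sin \<phi> *\<^sub>R w \<phi>) = T (A \<phi> *\<^sub>R cos \<phi> *\<^sub>R e_theta \<phi> \<theta>\<^sub>0
          + B \<phi> *\<^sub>R (- (sin \<phi> *\<^sub>R sph_point \<phi> \<theta>\<^sub>0 + cos \<phi> *\<^sub>R e_phi \<phi> \<theta>\<^sub>0))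
          + f1 \<phi> *\<^sub>R sin \<phi> *\<^sub>R e_theta \<phi> \<theta>\<^sub>0)"
      using vector_derivative_unique_at by simp
    then show ?thesis
      by (simp add: linear_scale[OF D_linear] T.add T.scaleR T.diff T.neg pt algebra_simps)
  qed
  have gP_w: "w \<phi> \<bullet> g \<phi> = 0" if \<phi>: "0 < \<phi>" "\<phi> < pi" for \<phi>
  proof -
    have "((\<lambda>\<theta>. P (T (sph_point \<phi> \<theta>))) has_vector_derivative (sin \<phi> *\<^sub>R w \<phi>) \<bullet> g \<phi>) (at \<theta>\<^sub>0)"
      using vector_derivative_diff_chain_within[OF ring, of P "\<lambda>h. h \<bullet> g \<phi>" \<phi>] DP[of \<phi>]
      by (simp add: o_def has_derivative_at_withinI n_def)
    moreover have "P (T (sph_point \<phi> \<theta>)) = Q \<phi>" for \<theta>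
      using P_sphere[OF norm_sph] sym[OF \<phi>] by simp
    ultimately have "(sin \<phi> *\<^sub>R w \<phi>) \<bullet> g \<phi> = 0"
      using vector_derivative_unique_at has_vector_derivative_const by fastforce
    then show ?thesis using sin_gt_zero[OF \<phi>] by simp
  qed
  have D_V: "D \<phi> (V (n \<phi>)) = A \<phi> *\<^sub>R D \<phi> (u \<phi>) + B \<phi> *\<^sub>R D \<phi> (w \<phi>) + f1 \<phi> *\<^sub>R - \<alpha> *\<^sub>R V (n \<phi>)" for \<phi>
    by (subst V_expand) (simp add: linear_add[OF D_linear] linear_scale[OF D_linear] D_ray)
  have momentum: "A \<phi> * (D \<phi> (u \<phi>) \<bullet> e) + B \<phi> * (D \<phi> (w \<phi>) \<bullet> e) - \<alpha> * f1 \<phi> * (V (n \<phi>) \<bullet> e) + e \<bullet> g \<phi> = 0"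
    for \<phi> e
    using arg_cong[OF mom[of \<phi>], of "\<lambda>x. x \<bullet> e"] unfolding D_V
    by (simp add: inner_left_distrib inner_diff_left algebra_simps inner_commute[of "g \<phi>"])
  \<comment> \<open>The zero trace of the Jacobian, computed in the moving frame.\<close>
  have divergence: "D \<phi> (n \<phi>) \<bullet> n \<phi> + D \<phi> (u \<phi>) \<bullet> u \<phi> + D \<phi> (w \<phi>) \<bullet> w \<phi> = 0" for \<phi>
    using euler[of \<phi> \<theta>\<^sub>0] trace_orthonormal_3[of "n \<phi>" "u \<phi>" "w \<phi>" "jacobian V (at (n \<phi>))"]
    unfolding stationary_euler_at_def divergence_def
    by (simp add: norm_eq_1 D_def inner_commute pt)
  have D_w_inner: "sin \<phi> * (D \<phi> (w \<phi>) \<bullet> n \<phi>) = - B \<phi> * sin \<phi>"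
    "sin \<phi> * (D \<phi> (w \<phi>) \<bullet> u \<phi>) = - B \<phi> * cos \<phi>"
    "sin \<phi> * (D \<phi> (w \<phi>) \<bullet> w \<phi>) = A \<phi> * cos \<phi> + f1 \<phi> * sin \<phi>"
    if "0 < \<phi>" "\<phi> < pi" for \<phi>
    using arg_cong[OF D_w[OF that], of "\<lambda>x. x \<bullet> n \<phi>"]
      arg_cong[OF D_w[OF that], of "\<lambda>x. x \<bullet> u \<phi>"] arg_cong[OF D_w[OF that], of "\<lambda>x. x \<bullet> w \<phi>"]
    by (simp_all add: inner_left_distrib inner_diff_left)
  \<comment> \<open>Differentiability of \<open>V\<close> alone does not make \<open>f1'\<close>
    continuous. As \<open>v\<close> is tangent, \<open>f1\<close> is \<open>f\<close> along
    \<open>n\<close>, hence locally a C^2 map \<open>G\<close> along \<open>n\<close>, and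
    \<open>f1'\<close> is the derivative of \<open>G\<close> in the direction
    \<open>u\<close>.\<close>
  have cont_f1': "isCont f1' \<phi>" for \<phi>
  proof -
    have "n \<phi> \<in> S2" using norm_sph by (simp add: n_def)
    then obtain U G where U: "open U" "n \<phi> \<in> U" and G: "Ck_on 2 G U" and Gf: "\<forall>x\<in>U \<inter> S2. G x = f x"
      using sol unfolding Ck_solution_def Ck_on_sphere_def by blast
    have cn: "isCont n \<phi>" "isCont u \<phi>" for \<phi>
      using Dn Du has_vector_derivative_continuous by blast+
    have "open (n -` U)"
      using U cn by (intro open_vimage continuous_at_imp_continuous_on) auto
    have f1_G: "f1 t = G (n t)" if "n t \<in> U" for t
    proof -
      have "n t \<in> S2" using norm_sph by (simp add: n_def)
      then have "v (n t) \<bullet> n t = 0" "G (n t) = f (n t)"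
        using sol that Gf unfolding Ck_solution_def tangent_field_def by blast+
      then show ?thesis
        using V_sphere[of "n t"] \<open>n t \<in> S2\<close> by (simp add: f1_def inner_left_distrib)
    qed
    have "f1' t = frechet_derivative G (at (n t)) (u t)" if t: "n t \<in> U" for t
    proof -
      have "G differentiable at (n t)" using G t by (simp add: numeral_2_eq_2)
      then have "(G has_derivative frechet_derivative G (at (n t))) (at (n t))"
        by (simp add: frechet_derivative_works)
      then have "((\<lambda>t. G (n t)) has_vector_derivative frechet_derivative G (at (n t)) (u t)) (at t)"
        using vector_derivative_diff_chain_within[OF Dn, of G _ t]
        by (simp add: o_def has_derivative_at_withinI)
      then have "(f1 has_vector_derivative frechet_derivative G (at (n t)) (u t)) (at t)"
        by (rule has_vector_derivative_transform_within_open[OF _ \<open>open (n -` U)\<close>])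
          (use t f1_G in auto)
      then show ?thesis
        using Df[of t] vector_derivative_unique_at
        unfolding has_real_derivative_iff_has_vector_derivative by blast
    qed
    then have "\<forall>\<^sub>F t in nhds \<phi>. f1' t = frechet_derivative G (at (n t)) (u t)"
      using \<open>open (n -` U)\<close> U(2) eventually_nhds_in_open[of "n -` U" \<phi>]
      by (auto elim!: eventually_mono)
    then show ?thesis
      using isCont_cong isCont_frechet_derivative_along[where \<gamma> = n and \<gamma>' = u, OF G U cn] by fast
  qed
  have "axisymmetric_ode \<alpha> A B f1 (\<lambda>\<phi>. P (n \<phi>)) A' B' f1' (\<lambda>\<phi>. u \<phi> \<bullet> g \<phi>)"
  proof
    fix \<phi> :: real
    assume \<phi>: "0 < \<phi>" "\<phi> < pi"
    have "- \<alpha> * f1 \<phi> + D \<phi> (u \<phi>) \<bullet> u \<phi> + D \<phi> (w \<phi>) \<bullet> w \<phi> = 0"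
      using divergence[of \<phi>] by (simp add: D_ray f1_def)
    then show "(2 - \<alpha>) * f1 \<phi> * sin \<phi> + A' \<phi> * sin \<phi> + A \<phi> * cos \<phi> = 0"
      using D_w_inner(3)[OF \<phi>] unfolding A'_def by algebra
    \<comment> \<open>The radial equation carries no factor \<open>sin \<phi>\<close>, so it is
      cancelled here, where it is positive.\<close>
    have "D \<phi> (w \<phi>) \<bullet> n \<phi> = - B \<phi>"
      using D_w_inner(1)[OF \<phi>] sin_gt_zero[OF \<phi>]
        mult_left_cancel[of "sin \<phi>" "D \<phi> (w \<phi>) \<bullet> n \<phi>" "- B \<phi>"] by (simp add: mult.commute)
    then have "A \<phi> * (D \<phi> (u \<phi>) \<bullet> n \<phi>) + B \<phi> * - B \<phi> - \<alpha> * f1 \<phi> * f1 \<phi> + - 2 * \<alpha> * P (n \<phi>) = 0"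
      using momentum[of \<phi> "n \<phi>"] by (simp add: gP_ray f1_def)
    then show "A \<phi> * f1' \<phi> = (A \<phi>)\<^sup>2 + (B \<phi>)\<^sup>2 + \<alpha> * (f1 \<phi>)\<^sup>2 + 2 * \<alpha> * P (n \<phi>)"
      unfolding f1'_def by algebra
    have "A \<phi> * (D \<phi> (u \<phi>) \<bullet> u \<phi>) + B \<phi> * (D \<phi> (w \<phi>) \<bullet> u \<phi>) - \<alpha> * f1 \<phi> * A \<phi> + u \<phi> \<bullet> g \<phi> = 0"
      using momentum[of \<phi> "u \<phi>"] by (simp add: A_def)
    then show "((1 - \<alpha>) * f1 \<phi> * A \<phi> + A \<phi> * A' \<phi> + u \<phi> \<bullet> g \<phi>) * sin \<phi> = (B \<phi>)\<^sup>2 * cos \<phi>"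
      using D_w_inner(2)[OF \<phi>] unfolding A'_def by algebra
    have "A \<phi> * B' \<phi> + B \<phi> * (D \<phi> (w \<phi>) \<bullet> w \<phi>) - \<alpha> * f1 \<phi> * B \<phi> = 0"
      using momentum[of \<phi> "w \<phi>"] gP_w[OF \<phi>] by (simp add: B_def B'_def)
    then show "((1 - \<alpha>) * f1 \<phi> * B \<phi> + A \<phi> * B' \<phi>) * sin \<phi> + A \<phi> * B \<phi> * cos \<phi> = 0"
      using D_w_inner(3)[OF \<phi>] by algebra
  qed (use alpha DA DB Df DPn cont_f1' in auto)
  then show ?thesis
    unfolding A_def[abs_def] B_def[abs_def] f1_def[abs_def] by blast
qed

section \<open>From the meridian to all of space\<close>

theorem proposition5p1:
  fixes \<alpha> :: real and v :: "real^3 \<Rightarrow> real^3" and f p :: "real^3 \<Rightarrow> real"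
  assumes "0 < \<alpha>" and "\<alpha> < 2"
    and "Ck_solution 2 \<alpha> v f p"
    and "axisymmetric v f p"
  shows "\<forall>x. x \<noteq> 0 \<longrightarrow> velocity \<alpha> v f x = 0"
proof (intro allI impI)
  fix x :: "real^3"
  assume "x \<noteq> 0"
  obtain T a b F Q where T: "orthogonal_transformation T"
    and sym: "\<And>\<phi> \<theta>. 0 < \<phi> \<Longrightarrow> \<phi> < pi \<Longrightarrow>
      v (T (sph_point \<phi> \<theta>)) = a \<phi> *\<^sub>R T (e_phi \<phi> \<theta>) + b \<phi> *\<^sub>R T (e_theta \<phi> \<theta>) \<and>
      f (T (sph_point \<phi> \<theta>)) = F \<phi> \<and> p (T (sph_point \<phi> \<theta>)) = Q \<phi>"
    using assms(4) unfolding axisymmetric_def by blast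
  obtain y where y: "sgn x = T y"
    using orthogonal_transformation_surj[OF T] by (rule surjE)
  then have "norm y = 1"
    using \<open>x \<noteq> 0\<close> orthogonal_transformation_norm[OF T, of y] norm_sgn[of x] by simp
  then obtain \<phi> \<theta> where \<phi>: "0 \<le> \<phi>" "\<phi> \<le> pi" and y_eq: "y = sph_point \<phi> \<theta>"
    by (rule sphere_polar_coordinates)
  \<comment> \<open>The meridian is chosen through the direction of \<open>x\<close>. Since
    \<open>zero\<close> holds on the closed interval, the poles are covered as well, and homogeneity
    then carries the result from \<open>sgn x\<close> to \<open>x\<close>.\<close>
  obtain a' b' f' p' where ode: "axisymmetric_ode \<alpha>
      (\<lambda>\<phi>. velocity \<alpha> v f (T (sph_point \<phi> \<theta>)) \<bullet> T (e_phi \<phi> \<theta>))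
      (\<lambda>\<phi>. velocity \<alpha> v f (T (sph_point \<phi> \<theta>)) \<bullet> T (e_theta \<phi> \<theta>))
      (\<lambda>\<phi>. velocity \<alpha> v f (T (sph_point \<phi> \<theta>)) \<bullet> T (sph_point \<phi> \<theta>))
      (\<lambda>\<phi>. pressure \<alpha> p (T (sph_point \<phi> \<theta>))) a' b' f' p'"
    using axisymmetric_solution_ode[OF assms(1-3) T sym, of \<theta>] by blast
  have "velocity \<alpha> v f (sgn x) = 0"
    unfolding y y_eq
    using orthogonal_frame_expansion[OF T, of "velocity \<alpha> v f (T (sph_point \<phi> \<theta>))" \<phi> \<theta>]
      axisymmetric_ode.zero[OF ode \<phi>] by simp
  then show "velocity \<alpha> v f x = 0"
    using velocity_scaleR[of "norm x" \<alpha> v f "sgn x"] \<open>x \<noteq> 0\<close> by (simp add: sgn_div_norm)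
qed

end
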